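(* Let $Q,G\in\mathbb{R}^{n\times n}$ be symmetric and let $\mathcal{S}=[s_1,\dots,s_q]\in\mathbb{R}^{n\times q}$ have columns that are $Q$-orthogonal, i.e. $s_i^TQs_j=0$ for $i\ne j$, with $s_i^TQs_i\neq0$ for $i=1,\dots,q$. Set $G^1:=G$ and $$G^{i+1}:=\mathrm{quNac}(G^i,\,s_i\to Qs_i),\qquad i=1,\dots,q .$$ Then $$\mathrm{quNac}(G,\,\mathcal{S}\to Q\mathcal{S})=G^{q+1}.$$
   Context: For a symmetric $Q\in\mathbb{R}^{n\times n}$, a matrix $G\in\mathbb{R}^{n\times n}$, and a matrix $\mathcal{S}\in\mathbb{R}^{n\times p}$ ($p\ge1$) such that $\mathcal{S}^TQ\mathcal{S}$ is invertible, the quNac update is $$\mathrm{quNac}(G,\mathcal{S}\to Q\mathcal{S}):=Q\Pi Q+(I-Q\Pi)\,G\,(I-\Pi Q),\qquad \Pi:=\mathcal{S}(\mathcal{S}^TQ\mathcal{S})^{-1}\mathcal{S}^T,$$ where $I$ is the $n\times n$ identity. For a single column $s\in\mathbb{R}^n$ (the case $p=1$), $\Pi=ss^T/(s^TQs)$. *)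

theory Defs
  imports Complex_Main "Jordan_Normal_Form.Gauss_Jordan_Elimination"
begin

text \<open>The matrix \<open>\<Pi> = S (S\<^sup>T Q S)\<^sup>-\<^sup>1 S\<^sup>T\<close>; it is only meaningful when \<open>S\<^sup>T Q S\<close> is invertible,
  since \<^const>\<open>mat_inverse\<close> returns \<^const>\<open>None\<close> otherwise.\<close>

definition quNac_Pi :: "real mat \<Rightarrow> real mat \<Rightarrow> real mat" where
  "quNac_Pi Q S = S * the (mat_inverse (transpose_mat S * Q * S)) * transpose_mat S"

text \<open>\<open>quNac Q G S\<close> is the update written \<open>quNac(G, S \<rightarrow> Q S)\<close>.\<close>

definition quNac :: "real mat \<Rightarrow> real mat \<Rightarrow> real mat \<Rightarrow> real mat" where
  "quNac Q G S =
    (let P = quNac_Pi Q S; I = 1\<^sub>m (dim_row Q)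
     in Q * P * Q + (I - Q * P) * G * (I - P * Q))"

end

theory Submission
  imports Defs "Jordan_Normal_Form.Determinant"
begin

text \<open>
  Write \<open>\<Pi>(S)\<close> for the matrix \<open>S (S\<^sup>T Q S)\<^sup>-\<^sup>1 S\<^sup>T\<close>. If the columns of \<open>S\<close> are \<open>Q\<close>-orthogonal, then
  \<open>S\<^sup>T Q S\<close> is diagonal, so \<open>\<Pi>(S)\<close> is the sum of the rank-one matrices \<open>s s\<^sup>T / (s\<^sup>T Q s)\<close> over the
  columns \<open>s\<close> (\<open>quNac_Pi_orthogonal\<close>). In particular, appending a column \<open>v\<close> turns \<open>P = \<Pi>(S)\<close>
  into \<open>P + R\<close> with \<open>R = \<Pi>(v)\<close>. Orthogonality also gives \<open>P Q R = R Q P = 0\<close>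
  (\<open>quNac_Pi_annihilate\<close>), hence
  \<open>(I - Q R)(I - Q P) = I - Q (P + R)\<close>, \<open>(I - P Q)(I - R Q) = I - (P + R) Q\<close>, and
  \<open>(I - Q R) (Q P Q) (I - R Q) = Q P Q\<close>. These three identities say exactly that the update with \<open>P\<close>
  followed by the update with \<open>R\<close> is the update with \<open>P + R\<close> (\<open>update_compose\<close>), and the theorem
  follows by induction on the number of columns.
\<close>

text \<open>Uniqueness of inverses lets a known inverse replace the output of Gauss-Jordan elimination.\<close>

lemma the_mat_inverse_eqI:
  fixes A B :: "'a::field mat"
  assumes A: "A \<in> carrier_mat n n" and B: "B \<in> carrier_mat n n" and BA: "B * A = 1\<^sub>m n"
  shows "the (mat_inverse A) = B"
proof -
  have AB: "A * B = 1\<^sub>m n"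
    using mat_mult_left_right_inverse[OF B A BA] .
  have "A \<in> Units (ring_mat TYPE('a) n ())"
    using A B BA AB by (auto simp: Units_def ring_mat_def)
  then obtain C where C: "mat_inverse A = Some C"
    using mat_inverse(1)[OF A, of "()"] by (cases "mat_inverse A") auto
  then have AC: "A * C = 1\<^sub>m n" and Cc: "C \<in> carrier_mat n n"
    using mat_inverse(2)[OF A] by auto
  have "C = B * A * C" using BA Cc by simp
  also have "\<dots> = B" using A B Cc AC by simp
  finally show ?thesis using C by simp
qed

text \<open>
  The equivalence covers both conditions on the columns: for \<open>i \<noteq> j\<close> it is orthogonality, and for
  \<open>i = j\<close> it excludes isotropic vectors, which an indefinite \<open>Q\<close> can have. Together they make the
  Gram matrix an invertible diagonal matrix.
\<close>

definition Q_orthogonal :: "real mat \<Rightarrow> real vec list \<Rightarrow> bool" where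
  "Q_orthogonal Q vs \<longleftrightarrow>
    (\<forall>i < length vs. \<forall>j < length vs. vs ! i \<bullet> (Q *\<^sub>v vs ! j) = 0 \<longleftrightarrow> i \<noteq> j)"

lemma gram_index:
  assumes Q: "Q \<in> carrier_mat n n" and us: "set us \<subseteq> carrier_vec n" and vs: "set vs \<subseteq> carrier_vec n"
    and i: "i < length us" and j: "j < length vs"
  shows "(transpose_mat (mat_of_cols n us) * Q * mat_of_cols n vs) $$ (i, j)
    = us ! i \<bullet> (Q *\<^sub>v vs ! j)"
proof -
  have ui: "us ! i \<in> carrier_vec n" and vj: "vs ! j \<in> carrier_vec n"
    using us vs i j nth_mem by blast+
  have "transpose_mat (mat_of_cols n us) * Q * mat_of_cols n vs
      = transpose_mat (mat_of_cols n us) * (Q * mat_of_cols n vs)"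
    using Q by (intro assoc_mult_mat[of _ "length us" n _ n _ "length vs"]) auto
  moreover have "col (Q * mat_of_cols n vs) j = Q *\<^sub>v vs ! j"
    using Q j vj by (subst col_mult2[of _ n n _ "length vs"]) auto
  ultimately show ?thesis
    using Q i j ui vj by simp
qed

lemma the_mat_inverse_gram:
  assumes Q: "Q \<in> carrier_mat n n" and vs: "set vs \<subseteq> carrier_vec n" and orth: "Q_orthogonal Q vs"
  shows "the (mat_inverse (transpose_mat (mat_of_cols n vs) * Q * mat_of_cols n vs))
    = mat_diag (length vs) (\<lambda>i. 1 / (vs ! i \<bullet> (Q *\<^sub>v vs ! i)))"
proof (rule the_mat_inverse_eqI)
  let ?d = "\<lambda>i. vs ! i \<bullet> (Q *\<^sub>v vs ! i)" and ?S = "mat_of_cols n vs"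
  have gram: "transpose_mat ?S * Q * ?S = mat_diag (length vs) ?d"
    using Q vs orth
    by (intro eq_matI) (auto simp: gram_index mat_diag_def Q_orthogonal_def
          simp del: index_mult_mat(1))
  show "transpose_mat ?S * Q * ?S \<in> carrier_mat (length vs) (length vs)"
    using gram by simp
  show "mat_diag (length vs) (\<lambda>i. 1 / ?d i) * (transpose_mat ?S * Q * ?S) = 1\<^sub>m (length vs)"
    unfolding gram mat_diag_diag using orth
    by (intro eq_matI) (auto simp: mat_diag_def Q_orthogonal_def)
qed auto

lemma quNac_Pi_orthogonal:
  assumes Q: "Q \<in> carrier_mat n n" and vs: "set vs \<subseteq> carrier_vec n" and orth: "Q_orthogonal Q vs"
  shows "quNac_Pi Q (mat_of_cols n vs)
    = mat n n (\<lambda>(a, b). \<Sum>v\<leftarrow>vs. v $ a * v $ b / (v \<bullet> (Q *\<^sub>v v)))"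
proof (rule eq_matI)
  fix a b
  assume "a < dim_row (mat n n (\<lambda>(a, b). \<Sum>v\<leftarrow>vs. v $ a * v $ b / (v \<bullet> (Q *\<^sub>v v))))"
    and "b < dim_col (mat n n (\<lambda>(a, b). \<Sum>v\<leftarrow>vs. v $ a * v $ b / (v \<bullet> (Q *\<^sub>v v))))"
  then have ab: "a < n" "b < n" by auto
  let ?d = "\<lambda>i. vs ! i \<bullet> (Q *\<^sub>v vs ! i)" and ?S = "mat_of_cols n vs"
  have "quNac_Pi Q ?S $$ (a, b)
      = (?S * mat_diag (length vs) (\<lambda>i. 1 / ?d i) * transpose_mat ?S) $$ (a, b)"
    unfolding quNac_Pi_def the_mat_inverse_gram[OF assms] ..
  also have "\<dots> = (\<Sum>i<length vs. vs ! i $ a * vs ! i $ b / ?d i)"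
    using ab by (simp add: mat_diag_mult_right[of _ n "length vs"] scalar_prod_def
        mat_of_cols_def atLeast0LessThan mult.commute)
  also have "\<dots> = (\<Sum>v\<leftarrow>vs. v $ a * v $ b / (v \<bullet> (Q *\<^sub>v v)))"
    by (simp add: sum_list_sum_nth atLeast0LessThan)
  finally show "quNac_Pi Q ?S $$ (a, b)
      = mat n n (\<lambda>(a, b). \<Sum>v\<leftarrow>vs. v $ a * v $ b / (v \<bullet> (Q *\<^sub>v v))) $$ (a, b)"
    using ab by simp
qed (simp_all add: quNac_Pi_def)

lemma quNac_Pi_carrier:
  "quNac_Pi Q (mat_of_cols n vs) \<in> carrier_mat n n"
  by (rule carrier_matI) (simp_all add: quNac_Pi_def)

text \<open>In \<open>\<Pi>(U) Q \<Pi>(V)\<close> the mixed Gram matrix \<open>U\<^sup>T Q V\<close> sits in the middle, so the product vanishes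
  as soon as the two families of columns are \<open>Q\<close>-orthogonal to each other.\<close>

lemma quNac_Pi_annihilate:
  assumes Q: "Q \<in> carrier_mat n n" and us: "set us \<subseteq> carrier_vec n" and vs: "set vs \<subseteq> carrier_vec n"
    and orth_us: "Q_orthogonal Q us" and orth_vs: "Q_orthogonal Q vs"
    and cross: "\<And>u v. u \<in> set us \<Longrightarrow> v \<in> set vs \<Longrightarrow> u \<bullet> (Q *\<^sub>v v) = 0"
  shows "quNac_Pi Q (mat_of_cols n us) * Q * quNac_Pi Q (mat_of_cols n vs) = 0\<^sub>m n n"
proof -
  let ?U = "mat_of_cols n us" and ?V = "mat_of_cols n vs"
  let ?k = "length us" and ?l = "length vs"
  have zero: "transpose_mat ?U * Q * ?V = 0\<^sub>m ?k ?l"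
    using Q us vs cross
    by (intro eq_matI) (auto simp: gram_index simp del: index_mult_mat(1))
  obtain E where E: "E \<in> carrier_mat ?k ?k" and PU: "quNac_Pi Q ?U = ?U * E * transpose_mat ?U"
    unfolding quNac_Pi_def the_mat_inverse_gram[OF Q us orth_us] using mat_diag_dim by blast
  obtain F where F: "F \<in> carrier_mat ?l ?l" and PV: "quNac_Pi Q ?V = ?V * F * transpose_mat ?V"
    unfolding quNac_Pi_def the_mat_inverse_gram[OF Q vs orth_vs] using mat_diag_dim by blast
  have U: "?U \<in> carrier_mat n ?k" and Ut: "transpose_mat ?U \<in> carrier_mat ?k n"
    and V: "?V \<in> carrier_mat n ?l" and Vt: "transpose_mat ?V \<in> carrier_mat ?l n" by auto
  note c = U Ut V Vt E F Q
  have UE: "?U * E \<in> carrier_mat n ?k" and FV: "F * transpose_mat ?V \<in> carrier_mat ?l n"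
    using c by auto
  have "quNac_Pi Q ?U * Q * quNac_Pi Q ?V
      = ?U * E * (transpose_mat ?U * Q) * (?V * (F * transpose_mat ?V))"
    unfolding PU PV using assoc_mult_mat[OF UE Ut Q] assoc_mult_mat[OF V F Vt] by simp
  also have "\<dots> = ?U * E * (transpose_mat ?U * Q * (?V * (F * transpose_mat ?V)))"
    using c by (intro assoc_mult_mat[of _ n ?k _ n _ n]) auto
  also have "transpose_mat ?U * Q * (?V * (F * transpose_mat ?V))
      = transpose_mat ?U * Q * ?V * (F * transpose_mat ?V)"
    using c by (intro assoc_mult_mat[of _ ?k n _ ?l _ n, symmetric]) auto
  finally show ?thesis
    unfolding zero left_mult_zero_mat[OF FV] right_mult_zero_mat[OF UE] .
qed

lemma one_minus_mult_one_minus: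
  fixes A B :: "'a::comm_ring_1 mat"
  assumes A: "A \<in> carrier_mat n n" and B: "B \<in> carrier_mat n n" and AB: "A * B = 0\<^sub>m n n"
  shows "(1\<^sub>m n - A) * (1\<^sub>m n - B) = 1\<^sub>m n - (A + B)"
proof -
  have "(1\<^sub>m n - A) * (1\<^sub>m n - B) = (1\<^sub>m n - B) - (A - A * B)"
    using minus_mult_distrib_mat[OF one_carrier_mat A minus_carrier_mat[OF B, of "1\<^sub>m n"]]
      mult_minus_distrib_mat[OF A one_carrier_mat B] A B by simp
  also have "\<dots> = 1\<^sub>m n - (A + B)"
    unfolding AB using A B by (intro eq_matI) auto
  finally show ?thesis .
qed

text \<open>
  The two vanishing products remove every mixed term: the second update leaves the contribution
  \<open>Q P Q\<close> of the first one unchanged, and its outer factors merge with those of the first.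
\<close>

lemma update_compose:
  fixes Q G P R :: "'a::comm_ring_1 mat"
  assumes Q: "Q \<in> carrier_mat n n" and G: "G \<in> carrier_mat n n"
    and P: "P \<in> carrier_mat n n" and R: "R \<in> carrier_mat n n"
    and PQR: "P * Q * R = 0\<^sub>m n n" and RQP: "R * Q * P = 0\<^sub>m n n"
  defines "I \<equiv> 1\<^sub>m n"
  shows "Q * R * Q + (I - Q * R) * (Q * P * Q + (I - Q * P) * G * (I - P * Q)) * (I - R * Q)
    = Q * (P + R) * Q + (I - Q * (P + R)) * G * (I - (P + R) * Q)"
proof -
  note c = Q G P R
  note assoc = assoc_mult_mat[of _ n n _ n _ n]
  have minus_zero: "A - 0\<^sub>m n n = A" if "A \<in> carrier_mat n n" for A :: "'a mat"
    using that by (intro eq_matI) auto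
  have QR: "Q * R \<in> carrier_mat n n" and QP: "Q * P \<in> carrier_mat n n"
    and RQ: "R * Q \<in> carrier_mat n n" and PQ: "P * Q \<in> carrier_mat n n"
    and QPQ: "Q * P * Q \<in> carrier_mat n n" using c by auto
  define X where "X = I - Q * R"
  define Y where "Y = I - R * Q"
  define X' where "X' = I - Q * P"
  define Y' where "Y' = I - P * Q"
  have X: "X \<in> carrier_mat n n" and Y: "Y \<in> carrier_mat n n"
    and X': "X' \<in> carrier_mat n n" and Y': "Y' \<in> carrier_mat n n"
    unfolding X_def Y_def X'_def Y'_def I_def using QR RQ QP PQ by (auto intro: minus_carrier_mat)
  have "Q * R * (Q * P) = Q * (R * Q * P)" using c by (simp add: assoc)
  then have QRQP: "Q * R * (Q * P) = 0\<^sub>m n n" unfolding RQP using Q by simp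
  have "P * Q * (R * Q) = P * Q * R * Q" using c by (simp add: assoc)
  then have PQRQ: "P * Q * (R * Q) = 0\<^sub>m n n" unfolding PQR using Q by simp
  have XX': "X * X' = I - Q * (P + R)"
  proof -
    have "X * X' = I - (Q * R + Q * P)"
      unfolding X_def X'_def I_def by (rule one_minus_mult_one_minus[OF QR QP QRQP])
    also have "Q * R + Q * P = Q * (P + R)"
      using mult_add_distrib_mat[OF Q P R] comm_add_mat[OF QR QP] by simp
    finally show ?thesis .
  qed
  have YY': "Y' * Y = I - (P + R) * Q"
  proof -
    have "Y' * Y = I - (P * Q + R * Q)"
      unfolding Y_def Y'_def I_def by (rule one_minus_mult_one_minus[OF PQ RQ PQRQ])
    also have "P * Q + R * Q = (P + R) * Q"
      using add_mult_distrib_mat[OF P R Q] by simp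
    finally show ?thesis .
  qed
  have XQPQ: "X * (Q * P * Q) = Q * P * Q"
  proof -
    have "X * (Q * P * Q) = Q * P * Q - Q * R * (Q * P * Q)"
      unfolding X_def I_def
      using minus_mult_distrib_mat[OF one_carrier_mat QR QPQ] left_mult_one_mat[OF QPQ] by simp
    also have "Q * R * (Q * P * Q) = Q * R * (Q * P) * Q"
      using assoc_mult_mat[OF QR QP Q] by simp
    finally show ?thesis unfolding QRQP using Q QPQ by (simp add: minus_zero)
  qed
  have QPQY: "Q * P * Q * Y = Q * P * Q"
  proof -
    have "Q * P * Q * Y = Q * P * Q - Q * P * Q * (R * Q)"
      unfolding Y_def I_def
      using mult_minus_distrib_mat[OF QPQ one_carrier_mat RQ] right_mult_one_mat[OF QPQ] by simp
    also have "Q * P * Q * (R * Q) = Q * (P * Q * (R * Q))"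
      using c by (simp add: assoc)
    finally show ?thesis unfolding PQRQ using Q QPQ by (simp add: minus_zero)
  qed
  have XGY: "X' * G * Y' \<in> carrier_mat n n"
    using X' G Y' by simp
  have "X * (Q * P * Q + X' * G * Y') * Y
      = X * (Q * P * Q) * Y + X * (X' * G * Y') * Y"
    using mult_add_distrib_mat[OF X QPQ XGY] add_mult_distrib_mat[OF mult_carrier_mat[OF X QPQ]
        mult_carrier_mat[OF X XGY] Y] by simp
  also have "X * (X' * G * Y') * Y = X * X' * G * (Y' * Y)"
    using X X' Y Y' G by (simp add: assoc)
  finally have step: "X * (Q * P * Q + X' * G * Y') * Y
      = Q * P * Q + X * X' * G * (Y' * Y)"
    unfolding XQPQ QPQY .
  have QRQ: "Q * R * Q \<in> carrier_mat n n" and XXGYY: "X * X' * G * (Y' * Y) \<in> carrier_mat n n"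
    using c X X' Y Y' by auto
  have "Q * R * Q + X * (Q * P * Q + X' * G * Y') * Y
      = Q * R * Q + Q * P * Q + X * X' * G * (Y' * Y)"
    unfolding step using QPQ QRQ XXGYY by (simp add: assoc_add_mat[of _ n n])
  also have "Q * R * Q + Q * P * Q = Q * (P + R) * Q"
    using mult_add_distrib_mat[OF Q P R] add_mult_distrib_mat[OF QP QR Q] comm_add_mat[OF QRQ QPQ]
    by simp
  finally show ?thesis unfolding XX' YY' unfolding X_def Y_def X'_def Y'_def .
qed

lemma Q_orthogonal_snocD:
  assumes "Q_orthogonal Q (vs @ [v])"
  shows "Q_orthogonal Q vs" and "Q_orthogonal Q [v]"
    and "u \<in> set vs \<Longrightarrow> u \<bullet> (Q *\<^sub>v v) = 0" and "u \<in> set vs \<Longrightarrow> v \<bullet> (Q *\<^sub>v u) = 0"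
proof -
  have *: "(vs @ [v]) ! i \<bullet> (Q *\<^sub>v (vs @ [v]) ! j) = 0 \<longleftrightarrow> i \<noteq> j"
    if "i \<le> length vs" "j \<le> length vs" for i j
    using assms that by (simp add: Q_orthogonal_def)
  show "Q_orthogonal Q vs"
    unfolding Q_orthogonal_def using * by (metis less_imp_le nth_append)
  show "Q_orthogonal Q [v]"
    unfolding Q_orthogonal_def using *[of "length vs" "length vs"] by simp
  {
    assume "u \<in> set vs"
    then obtain i where "i < length vs" "u = vs ! i" by (metis in_set_conv_nth)
    then show "u \<bullet> (Q *\<^sub>v v) = 0" and "v \<bullet> (Q *\<^sub>v u) = 0"
      using *[of i "length vs"] *[of "length vs" i] by (auto simp: nth_append)
  }
qed

text \<open>
  This lets the induction start at zero columns: \<open>S\<^sup>T Q S\<close> is then the invertible 0-by-0 matrix, and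
  \<open>\<Pi>(S)\<close> is an empty sum.
\<close>

lemma quNac_no_columns:
  assumes Q: "Q \<in> carrier_mat n n" and G: "G \<in> carrier_mat n n"
  shows "quNac Q G (mat_of_cols n []) = G"
proof -
  have "quNac_Pi Q (mat_of_cols n []) = 0\<^sub>m n n"
    using quNac_Pi_orthogonal[OF Q, of "[]"] by (auto simp: Q_orthogonal_def)
  moreover have "1\<^sub>m n - 0\<^sub>m n n = (1\<^sub>m n :: real mat)"
    by (intro eq_matI) auto
  ultimately show ?thesis
    using Q G by (simp add: quNac_def Let_def)
qed

lemma quNac_snoc:
  assumes Q: "Q \<in> carrier_mat n n" and G: "G \<in> carrier_mat n n"
    and vs: "set (vs @ [v]) \<subseteq> carrier_vec n" and orth: "Q_orthogonal Q (vs @ [v])"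
  shows "quNac Q G (mat_of_cols n (vs @ [v]))
    = quNac Q (quNac Q G (mat_of_cols n vs)) (mat_of_cols n [v])"
proof -
  define P where "P = quNac_Pi Q (mat_of_cols n vs)"
  define R where "R = quNac_Pi Q (mat_of_cols n [v])"
  note orth' = Q_orthogonal_snocD[OF orth]
  have P: "P \<in> carrier_mat n n" and R: "R \<in> carrier_mat n n"
    unfolding P_def R_def by (rule quNac_Pi_carrier)+
  have add: "quNac_Pi Q (mat_of_cols n (vs @ [v])) = P + R"
    unfolding P_def R_def using vs
    by (intro eq_matI) (auto simp: quNac_Pi_orthogonal[OF Q] orth orth'(1,2))
  have "P * Q * R = 0\<^sub>m n n" "R * Q * P = 0\<^sub>m n n"
    unfolding P_def R_def using vs orth' by (auto intro!: quNac_Pi_annihilate[OF Q])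
  from update_compose[OF Q G P R this] show ?thesis
    using Q by (simp add: quNac_def Let_def add flip: P_def R_def)
qed

theorem proposition2p3:
  fixes n q :: nat and Q G S :: "real mat"
    and s :: "nat \<Rightarrow> real vec" and H :: "nat \<Rightarrow> real mat"
  assumes "1 \<le> q"
    and "Q \<in> carrier_mat n n" and "transpose_mat Q = Q"
    and "G \<in> carrier_mat n n" and "transpose_mat G = G"
    and "\<And>i. i \<in> {1..q} \<Longrightarrow> s i \<in> carrier_vec n"
    and "S = mat_of_cols n (map s [1..<q + 1])"
    and "\<And>i j. i \<in> {1..q} \<Longrightarrow> j \<in> {1..q} \<Longrightarrow> i \<noteq> j \<Longrightarrow> s i \<bullet> (Q *\<^sub>v s j) = 0"
    and "\<And>i. i \<in> {1..q} \<Longrightarrow> s i \<bullet> (Q *\<^sub>v s i) \<noteq> 0"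
    and "H 1 = G"
    and "\<And>i. i \<in> {1..q} \<Longrightarrow> H (i + 1) = quNac Q (H i) (mat_of_cols n [s i])"
  shows "quNac Q G S = H (q + 1)"
proof -
  have "quNac Q G (mat_of_cols n (map s [1..<k + 1])) = H (k + 1)" if "k \<le> q" for k
    using that
  proof (induction k)
    case 0
    show ?case using quNac_no_columns[OF assms(2,4)] assms(10) by simp
  next
    case (Suc k)
    have snoc: "map s [1..<Suc k + 1] = map s [1..<k + 1] @ [s (Suc k)]"
      by simp
    have orth: "Q_orthogonal Q (map s [1..<Suc k + 1])"
      unfolding Q_orthogonal_def
    proof (intro allI impI)
      fix i j assume "i < length (map s [1..<Suc k + 1])" "j < length (map s [1..<Suc k + 1])"
      then have ij: "i \<le> k" "j \<le> k" by (simp_all del: upt_Suc)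
      then have nth: "map s [1..<Suc k + 1] ! i = s (Suc i)" "map s [1..<Suc k + 1] ! j = s (Suc j)"
        by (simp_all del: upt_Suc)
      show "(map s [1..<Suc k + 1] ! i \<bullet> (Q *\<^sub>v map s [1..<Suc k + 1] ! j) = 0) = (i \<noteq> j)"
        unfolding nth using assms(8)[of "Suc i" "Suc j"] assms(9)[of "Suc i"] ij Suc.prems by auto
    qed
    have carrier: "set (map s [1..<Suc k + 1]) \<subseteq> carrier_vec n"
    proof
      fix v assume "v \<in> set (map s [1..<Suc k + 1])"
      then obtain i where "v = s i" "i \<in> {1..<Suc k + 1}" by (auto simp del: upt_Suc)
      then show "v \<in> carrier_vec n" using assms(6)[of i] Suc.prems by auto
    qed
    have "quNac Q G (mat_of_cols n (map s [1..<Suc k + 1]))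
        = quNac Q (H (k + 1)) (mat_of_cols n [s (Suc k)])"
      unfolding snoc quNac_snoc[OF assms(2,4) carrier[unfolded snoc] orth[unfolded snoc]]
        Suc.IH[OF Suc_leD[OF Suc.prems]] ..
    also have "\<dots> = H (Suc k + 1)"
      using assms(11)[of "Suc k"] Suc.prems by simp
    finally show ?case .
  qed
  from this[of q] show ?thesis unfolding assms(7) by blast
qed

end
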